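(* Let $0\le\alpha<1$, let $n\ge 2$, and let $G$ be a simple strongly connected digraph of order $n$. Then $$n-1\le \mu_\alpha(G)\le \frac{n(n-1)}{2}.$$ Moreover, $\mu_\alpha(G)=n-1$ if and only if $G\cong \overset{\longleftrightarrow}{K_n}$, and $\mu_\alpha(G)=\frac{n(n-1)}{2}$ if and only if $G\cong C_n$.
   Context: Digraphs are finite and simple (no loops, no multiple arcs; two opposite arcs $(u,v),(v,u)$ are allowed). A digraph is strongly connected if for every ordered pair of vertices there is a directed path from the first to the second. For a strongly connected digraph $G$ with vertices $v_1,\dots,v_n$, $D(G)=(d_{ij})$ is the distance matrix, where $d_{ij}$ is the length of a shortest directed path from $v_i$ to $v_j$; $D_i=\sum_{j=1}^n d_{ij}$ is the transmission of $v_i$; $Diag(Tr)=\mathrm{diag}(D_1,\dots,D_n)$; and $D_\alpha(G)=\alpha\, Diag(Tr)+(1-\alpha)D(G)$. The $D_\alpha$ spectral radius $\mu_\alpha(G)$ is the spectral radius of $D_\alpha(G)$, i.e. its eigenvalue of largest modulus. $\overset{\longleftrightarrow}{K_n}$ is the complete digraph on $n$ vertices (both arcs between every two distinct vertices) and $C_n$ is the directed cycle on $n$ vertices. *)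

theory Defs
  imports
    "Graph_Theory.Digraph_Isomorphism"
    "Graph_Theory.Shortest_Path"
    "Jordan_Normal_Form.Spectral_Radius"
begin

definition digraph_dist :: "('a, 'b) pre_digraph \<Rightarrow> 'a \<Rightarrow> 'a \<Rightarrow> nat" where
  "digraph_dist G u w = (LEAST k. \<exists>p. pre_digraph.apath G u p w \<and> length p = k)"

text \<open>
  Consistency with the weighted distance of the library for unit arc weights, which is an infimum
  over walks in the extended reals.
\<close>

lemma (in wf_digraph) digraph_dist_eq_mu:
  assumes "u \<rightarrow>\<^sup>* w"
  shows "ereal (real (digraph_dist G u w)) = \<mu> (\<lambda>_. 1) u w"
proof -
  let ?P = "\<lambda>k. \<exists>p. apath u p w \<and> length p = k"
  have cost: "awalk_cost (\<lambda>_. 1) p = real (length p)" for p :: "'b list"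
    by (induction p) simp_all
  obtain p0 where "apath u p0 w"
    using assms reachable_apath by blast
  then have "?P (length p0)" by blast
  then have "?P (digraph_dist G u w)"
    unfolding digraph_dist_def by (rule LeastI)
  then obtain p where p: "apath u p w" "length p = digraph_dist G u w"
    by blast
  show ?thesis
  proof (rule antisym)
    show "ereal (real (digraph_dist G u w)) \<le> \<mu> (\<lambda>_. 1) u w"
      unfolding \<mu>_def
    proof (rule INF_greatest)
      fix q assume "q \<in> {p. awalk u p w}"
      then have q: "awalk u q w" by simp
      have "apath u (awalk_to_apath q) w"
        by (rule apath_awalk_to_apath[OF q])
      then have "digraph_dist G u w \<le> length (awalk_to_apath q)"
        unfolding digraph_dist_def by (intro Least_le) blast
      also have "length (awalk_to_apath q) \<le> length q"
        using awalk_to_path_no_neg_cyc_cost[OF q, of "\<lambda>_. 1"] by (simp add: cost)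
      finally show "ereal (real (digraph_dist G u w)) \<le> ereal (awalk_cost (\<lambda>_. 1) q)"
        by (simp add: cost)
    qed
  next
    show "\<mu> (\<lambda>_. 1) u w \<le> ereal (real (digraph_dist G u w))"
      using min_cost_le_walk_cost[of u p w "\<lambda>_. 1"] p by (simp add: cost apath_def)
  qed
qed

text \<open>
  The matrices are indexed by an enumeration v 0, ..., v (n - 1) of the vertices of a digraph.
\<close>

definition distance_matrix :: "('a, 'b) pre_digraph \<Rightarrow> nat \<Rightarrow> (nat \<Rightarrow> 'a) \<Rightarrow> real mat" where
  "distance_matrix G n v = mat n n (\<lambda>(i, j). real (digraph_dist G (v i) (v j)))"

definition transmission :: "('a, 'b) pre_digraph \<Rightarrow> nat \<Rightarrow> (nat \<Rightarrow> 'a) \<Rightarrow> nat \<Rightarrow> real" where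
  "transmission G n v i = (\<Sum>j<n. distance_matrix G n v $$ (i, j))"

definition D_alpha_matrix :: "real \<Rightarrow> ('a, 'b) pre_digraph \<Rightarrow> nat \<Rightarrow> (nat \<Rightarrow> 'a) \<Rightarrow> real mat" where
  "D_alpha_matrix \<alpha> G n v =
     \<alpha> \<cdot>\<^sub>m mat_diag n (transmission G n v) + (1 - \<alpha>) \<cdot>\<^sub>m distance_matrix G n v"

definition D_alpha_spectral_radius :: "real \<Rightarrow> ('a, 'b) pre_digraph \<Rightarrow> nat \<Rightarrow> (nat \<Rightarrow> 'a) \<Rightarrow> real" where
  "D_alpha_spectral_radius \<alpha> G n v =
     spectral_radius (map_mat complex_of_real (D_alpha_matrix \<alpha> G n v))"

definition complete_digraph_on :: "nat \<Rightarrow> (nat, nat \<times> nat) pre_digraph" where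
  "complete_digraph_on n =
     \<lparr> verts = {..<n}, arcs = {(i, j). i < n \<and> j < n \<and> i \<noteq> j}, tail = fst, head = snd \<rparr>"

lemma digraph_complete_digraph_on: "digraph (complete_digraph_on n)"
proof -
  have "arcs (complete_digraph_on n) \<subseteq> {..<n} \<times> {..<n}"
    by (auto simp: complete_digraph_on_def)
  then have "finite (arcs (complete_digraph_on n))"
    by (rule finite_subset) simp
  then show ?thesis
    by unfold_locales (auto simp: complete_digraph_on_def arc_to_ends_def)
qed

text \<open>For n = 1 the following has a loop; it is a simple digraph only for n \<noteq> 1.\<close>

definition directed_cycle :: "nat \<Rightarrow> (nat, nat \<times> nat) pre_digraph" where
  "directed_cycle n =
     \<lparr> verts = {..<n}, arcs = {(i, Suc i mod n) | i. i < n}, tail = fst, head = snd \<rparr>"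

lemma digraph_directed_cycle:
  assumes "n \<ge> 2"
  shows "digraph (directed_cycle n)"
proof -
  have "i \<noteq> Suc i mod n" if "i < n" for i
    using that assms by (cases "Suc i = n") auto
  then show ?thesis
    by unfold_locales (auto simp: directed_cycle_def arc_to_ends_def)
qed

end

theory Submission
  imports Defs
begin

text \<open>
  The matrix D_alpha is nonnegative, its off-diagonal entries are positive because \<open>\<alpha> < 1\<close>, and its
  i-th row sum is the transmission of the i-th vertex, since the weights \<open>\<alpha>\<close> and \<open>1 - \<alpha>\<close> add up to 1.
  The spectral radius of such a matrix lies between its smallest and its largest row sum, and if it
  equals a lower or an upper bound of the row sums, then every row sum equals that bound. So each
  extremal value of the spectral radius is attained exactly when all transmissions are extremal, and
  the rest is counting distances.

  The upper half of the spectral fact comes from comparing moduli in an eigenvector at an entry of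
  largest modulus (\<open>spectral_radius_le_max_row_sum\<close>, \<open>row_sums_eq_if_spectral_radius_eq_max\<close>). The lower
  half would follow from a positive Perron vector; instead it is derived from the Collatz-Wielandt
  inequality \<open>spectral_radius_ge_if_subinvariant\<close>: if \<open>A x \<ge> r x\<close> for a positive vector x, then the powers
  of A grow at least like \<open>r ^ k\<close>, while the powers of a matrix of spectral radius less than 1 are bounded.
  The vector of ones gives the bound. If one row sum exceeds it, then raising the entry of that row
  slightly makes the inequality strict in all rows.

  A transmission is at least \<open>n - 1\<close>, with equality iff all other vertices are out-neighbours
  (\<open>sum_dist_ge_card\<close>, \<open>sum_dist_eq_card_iff\<close>). The distances from a vertex take every value below their
  maximum, so the transmission is at most \<open>0 + 1 + \<dots> + (n - 1)\<close>, with equality iff no two vertices are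
  at the same distance (\<open>sum_dist_le\<close>, \<open>sum_dist_eq_iff\<close>). This happens at every vertex iff every
  out-degree is 1, which for a strongly connected digraph says that it is a directed cycle
  (\<open>inj_on_dist_iff_unique_out_neighbour\<close>, \<open>digraph_iso_cycle_iff\<close>).
\<close>

section \<open>Row sums and the spectral radius of a nonnegative matrix\<close>

lemma mult_mat_vec_nth:
  assumes "A \<in> carrier_mat n m" "x \<in> carrier_vec m" "i < n"
  shows "(A *\<^sub>v x) $ i = (\<Sum>j<m. A $$ (i, j) * x $ j)"
  using assms by (simp add: scalar_prod_def lessThan_atLeast0)

abbreviation real_spectral_radius :: "real mat \<Rightarrow> real" where
  "real_spectral_radius A \<equiv> spectral_radius (map_mat complex_of_real A)"

lemma spectral_radius_eigenvectorE:
  assumes A: "A \<in> carrier_mat n n" and n: "n > 0"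
  obtains z where "z \<in> carrier_vec n" "z \<noteq> 0\<^sub>v n"
    "\<And>i. i < n \<Longrightarrow> real_spectral_radius A * cmod (z $ i) \<le> (\<Sum>j<n. \<bar>A $$ (i, j)\<bar> * cmod (z $ j))"
proof -
  let ?A = "map_mat complex_of_real A"
  have cA: "?A \<in> carrier_mat n n" using A by simp
  from spectral_radius_mem_max(1)[OF cA n] obtain ev
    where ev: "eigenvalue ?A ev" "real_spectral_radius A = cmod ev"
    by (auto simp: spectrum_def)
  then obtain z where z: "z \<in> carrier_vec n" "z \<noteq> 0\<^sub>v n" "?A *\<^sub>v z = ev \<cdot>\<^sub>v z"
    using cA by (auto simp: eigenvalue_def eigenvector_def)
  have "real_spectral_radius A * cmod (z $ i) \<le> (\<Sum>j<n. \<bar>A $$ (i, j)\<bar> * cmod (z $ j))"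
    if i: "i < n" for i
  proof -
    have "ev * z $ i = (?A *\<^sub>v z) $ i" using z i by simp
    also have "\<dots> = (\<Sum>j<n. complex_of_real (A $$ (i, j)) * z $ j)"
      using z(1) A i by (auto simp: scalar_prod_def lessThan_atLeast0 intro!: sum.cong)
    finally have "cmod (ev * z $ i) \<le> (\<Sum>j<n. cmod (complex_of_real (A $$ (i, j)) * z $ j))"
      using norm_sum by metis
    then show ?thesis by (simp add: ev norm_mult)
  qed
  with z that show ?thesis by blast
qed

lemma spectral_radius_nonneg:
  assumes "A \<in> carrier_mat n n" "n > 0"
  shows "real_spectral_radius A \<ge> 0"
  using spectral_radius_mem_max(1)[of "map_mat complex_of_real A" n] assms by auto

text \<open>
  Let z be an eigenvector of an eigenvalue of largest modulus and i an index at which \<open>|z i|\<close> is maximal.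
  Row i of the eigenvector equation gives \<open>\<rho> |z i| \<le> S |z i|\<close> for its row sum S
  and the spectral radius \<open>\<rho>\<close>. If \<open>\<rho> = R\<close>, no loss is
  possible in this row, so \<open>|z j| = |z i|\<close> wherever the entry \<open>(i, j)\<close> is positive. With positive
  off-diagonal entries all moduli coincide, hence every row could have played the role of row i.
\<close>

lemma
  assumes A: "A \<in> carrier_mat n n" and n: "n > 0"
    and nonneg: "\<And>i j. i < n \<Longrightarrow> j < n \<Longrightarrow> A $$ (i, j) \<ge> 0"
    and rows: "\<And>i. i < n \<Longrightarrow> (\<Sum>j<n. A $$ (i, j)) \<le> R"
  shows spectral_radius_le_max_row_sum: "real_spectral_radius A \<le> R"
    and row_sums_eq_if_spectral_radius_eq_max:
      "\<lbrakk>real_spectral_radius A = R; \<And>i j. i < n \<Longrightarrow> j < n \<Longrightarrow> i \<noteq> j \<Longrightarrow> A $$ (i, j) > 0; k < n\<rbrakk>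
        \<Longrightarrow> (\<Sum>j<n. A $$ (k, j)) = R"
proof -
  obtain z where z: "z \<in> carrier_vec n" "z \<noteq> 0\<^sub>v n"
    and le0: "\<And>i. i < n \<Longrightarrow> real_spectral_radius A * cmod (z $ i) \<le> (\<Sum>j<n. \<bar>A $$ (i, j)\<bar> * cmod (z $ j))"
    using spectral_radius_eigenvectorE[OF A n] by blast
  have le: "real_spectral_radius A * cmod (z $ i) \<le> (\<Sum>j<n. A $$ (i, j) * cmod (z $ j))"
    if "i < n" for i
  proof -
    have "(\<Sum>j<n. \<bar>A $$ (i, j)\<bar> * cmod (z $ j)) = (\<Sum>j<n. A $$ (i, j) * cmod (z $ j))"
      using that nonneg by (intro sum.cong) auto
    then show ?thesis using le0[OF that] by simp
  qed
  define m where "m = Max ((\<lambda>i. cmod (z $ i)) ` {..<n})"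
  have m_ge: "cmod (z $ i) \<le> m" if "i < n" for i
    unfolding m_def using that by (intro Max_ge) auto
  have "m \<in> (\<lambda>i. cmod (z $ i)) ` {..<n}"
    unfolding m_def using n by (intro Max_in) auto
  then obtain i where i: "i < n" "cmod (z $ i) = m" by auto
  obtain l where l: "l < n" "z $ l \<noteq> 0"
    using z by (metis eq_vecI carrier_vecD index_zero_vec(1,2))
  have m: "m > 0" using m_ge[OF l(1)] l(2) by (smt (verit) zero_less_norm_iff)
  have bound: "real_spectral_radius A * cmod (z $ k) \<le> m * (\<Sum>j<n. A $$ (k, j))"
    if "k < n" for k
  proof -
    have "(\<Sum>j<n. A $$ (k, j) * cmod (z $ j)) \<le> (\<Sum>j<n. A $$ (k, j) * m)"
      using that nonneg m_ge by (intro sum_mono mult_left_mono) auto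
    then show ?thesis using le[OF that] by (simp add: sum_distrib_left mult.commute)
  qed
  have "real_spectral_radius A * m \<le> m * R"
    using bound[OF i(1)] rows[OF i(1)] m i(2) by (smt (verit) mult_left_mono)
  then show "real_spectral_radius A \<le> R" using m by simp
  assume eq: "real_spectral_radius A = R"
    and pos: "\<And>i j. i < n \<Longrightarrow> j < n \<Longrightarrow> i \<noteq> j \<Longrightarrow> A $$ (i, j) > 0"
    and k: "k < n"
  have "(\<Sum>j<n. A $$ (i, j) * (m - cmod (z $ j))) \<le> 0"
  proof -
    have "(\<Sum>j<n. A $$ (i, j) * (m - cmod (z $ j)))
        = m * (\<Sum>j<n. A $$ (i, j)) - (\<Sum>j<n. A $$ (i, j) * cmod (z $ j))"
      by (simp add: algebra_simps sum_subtractf sum_distrib_left)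
    also have "\<dots> \<le> m * R - R * m"
      using le[OF i(1)] rows[OF i(1)] m i(2) eq by (intro diff_mono mult_left_mono) auto
    finally show ?thesis by simp
  qed
  moreover have nn: "A $$ (i, j) * (m - cmod (z $ j)) \<ge> 0" if "j < n" for j
    using nonneg i(1) that m_ge by auto
  ultimately have "(\<Sum>j<n. A $$ (i, j) * (m - cmod (z $ j))) = 0"
    by (intro antisym sum_nonneg) auto
  then have "A $$ (i, j) * (m - cmod (z $ j)) = 0" if "j < n" for j
    using nn that by (subst (asm) sum_nonneg_eq_0_iff) auto
  then have "cmod (z $ k) = m"
    using pos[OF i(1) k] i k by (cases "k = i") fastforce+
  with bound[OF k] eq have "R * m \<le> m * (\<Sum>j<n. A $$ (k, j))" by simp
  then have "R \<le> (\<Sum>j<n. A $$ (k, j))" using m by simp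
  with rows[OF k] show "(\<Sum>j<n. A $$ (k, j)) = R" by simp
qed

lemma spectral_radius_smult_le:
  fixes A :: "complex mat"
  assumes A: "A \<in> carrier_mat n n" and n: "n > 0" and c: "c \<noteq> 0"
  shows "spectral_radius (c \<cdot>\<^sub>m A) \<le> cmod c * spectral_radius A"
proof -
  have cA: "c \<cdot>\<^sub>m A \<in> carrier_mat n n" using A by simp
  from spectral_radius_mem_max(1)[OF cA n] obtain ev
    where ev: "eigenvalue (c \<cdot>\<^sub>m A) ev" "spectral_radius (c \<cdot>\<^sub>m A) = cmod ev"
    by (auto simp: spectrum_def)
  then obtain z where z: "z \<in> carrier_vec n" "z \<noteq> 0\<^sub>v n" "(c \<cdot>\<^sub>m A) *\<^sub>v z = ev \<cdot>\<^sub>v z"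
    using A by (auto simp: eigenvalue_def eigenvector_def)
  have "A *\<^sub>v z = (ev / c) \<cdot>\<^sub>v z"
  proof (rule eq_vecI)
    fix i assume i: "i < dim_vec ((ev / c) \<cdot>\<^sub>v z)"
    then have "((c \<cdot>\<^sub>m A) *\<^sub>v z) $ i = ev * z $ i" using z by simp
    moreover have "((c \<cdot>\<^sub>m A) *\<^sub>v z) $ i = c * (A *\<^sub>v z) $ i"
      using i z(1) A by (simp add: row_def scalar_prod_def sum_distrib_left mult.assoc)
    ultimately show "(A *\<^sub>v z) $ i = ((ev / c) \<cdot>\<^sub>v z) $ i"
      using i c by (simp add: field_simps)
  qed (use A z in auto)
  then have "ev / c \<in> spectrum A"
    using A z by (auto simp: spectrum_def eigenvalue_def eigenvector_def)
  then have "cmod (ev / c) \<le> spectral_radius A"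
    using spectral_radius_mem_max(2)[OF A n] by blast
  then show ?thesis using ev(2) c by (simp add: norm_divide divide_le_eq mult.commute)
qed

text \<open>
  The induction needs an arbitrary vector y above a multiple of x: with \<open>B ^ (k + 1) y = B ^ k (B y)\<close>, a
  single application of B to y multiplies the factor c by t.
\<close>

lemma pow_mat_vec_lower_bound:
  fixes B :: "real mat"
  assumes B: "B \<in> carrier_mat n n" and x: "x \<in> carrier_vec n"
    and nonneg: "\<And>i j. i < n \<Longrightarrow> j < n \<Longrightarrow> B $$ (i, j) \<ge> 0"
    and sub: "\<And>i. i < n \<Longrightarrow> t * x $ i \<le> (B *\<^sub>v x) $ i" and t: "t \<ge> 0"
    and "y \<in> carrier_vec n" "c \<ge> 0" "\<And>i. i < n \<Longrightarrow> c * x $ i \<le> y $ i" "i < n"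
  shows "c * t ^ k * x $ i \<le> (B ^\<^sub>m k *\<^sub>v y) $ i"
  using assms(6-)
proof (induction k arbitrary: y c)
  case 0
  then show ?case using B by simp
next
  case (Suc k)
  have By: "B *\<^sub>v y \<in> carrier_vec n" using B Suc.prems by simp
  have "c * t * x $ i \<le> (B *\<^sub>v y) $ i" if i: "i < n" for i
  proof -
    have "c * (t * x $ i) \<le> c * (B *\<^sub>v x) $ i"
      using sub[OF i] Suc.prems(2) by (rule mult_left_mono)
    also have "\<dots> = (\<Sum>j<n. B $$ (i, j) * (c * x $ j))"
      using mult_mat_vec_nth[OF B x i] by (simp add: sum_distrib_left mult_ac)
    also have "\<dots> \<le> (\<Sum>j<n. B $$ (i, j) * y $ j)"
      using Suc.prems(3) nonneg i by (intro sum_mono mult_left_mono) auto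
    also have "\<dots> = (B *\<^sub>v y) $ i"
      using mult_mat_vec_nth[OF B Suc.prems(1) i] by simp
    finally show ?thesis by (simp add: mult.assoc)
  qed
  then have "c * t * t ^ k * x $ i \<le> (B ^\<^sub>m k *\<^sub>v (B *\<^sub>v y)) $ i"
    using Suc.IH[OF By, of "c * t"] Suc.prems t by simp
  moreover have "B ^\<^sub>m Suc k *\<^sub>v y = B ^\<^sub>m k *\<^sub>v (B *\<^sub>v y)"
    using B Suc.prems(1) by (simp add: assoc_mult_mat_vec[of _ n n _ n])
  ultimately show ?case by (simp add: mult.assoc)
qed

text \<open>
  The Collatz-Wielandt lower bound. If the spectral radius were below r, then A could be scaled by
  some s strictly between the two. The powers of \<open>A / s\<close> would be bounded, as its spectral radius is
  less than 1, and yet they would stretch x by at least \<open>(r / s) ^ k\<close> with \<open>r / s > 1\<close>.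
\<close>

lemma spectral_radius_ge_if_subinvariant:
  fixes A :: "real mat"
  assumes A: "A \<in> carrier_mat n n" and n: "n > 0" and x: "x \<in> carrier_vec n"
    and nonneg: "\<And>i j. i < n \<Longrightarrow> j < n \<Longrightarrow> A $$ (i, j) \<ge> 0"
    and pos: "\<And>i. i < n \<Longrightarrow> x $ i > 0"
    and sub: "\<And>i. i < n \<Longrightarrow> r * x $ i \<le> (A *\<^sub>v x) $ i"
  shows "r \<le> real_spectral_radius A"
proof (rule ccontr)
  assume "\<not> r \<le> real_spectral_radius A"
  then obtain s where s: "real_spectral_radius A < s" "s < r"
    using dense[of "real_spectral_radius A" r] by auto
  have s0: "s > 0" using s spectral_radius_nonneg[OF A n] by simp
  define B where "B = (1 / s) \<cdot>\<^sub>m A"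
  define t where "t = r / s"
  have B: "B \<in> carrier_mat n n" using A by (simp add: B_def)
  have t: "t > 1" using s s0 by (simp add: t_def)
  have map_B: "map_mat complex_of_real B = complex_of_real (1 / s) \<cdot>\<^sub>m map_mat complex_of_real A"
    by (auto simp: B_def)
  have "real_spectral_radius B \<le> cmod (complex_of_real (1 / s)) * real_spectral_radius A"
    unfolding map_B using A n s0 by (intro spectral_radius_smult_le[of _ n]) auto
  also have "\<dots> = real_spectral_radius A / s" using s0 by (simp add: norm_divide)
  also have "\<dots> < 1" using s s0 by simp
  finally have "real_spectral_radius B < 1" .
  then obtain b where b: "\<And>k. norm_bound (map_mat complex_of_real B ^\<^sub>m k) b"
    using spectral_radius_jnf_norm_bound_less_1_upper_triangular[of "map_mat complex_of_real B" n] B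
    by auto
  have pow_le: "\<bar>(B ^\<^sub>m k) $$ (i, j)\<bar> \<le> b" if "i < n" "j < n" for i j k
  proof -
    have "map_mat complex_of_real B ^\<^sub>m k = map_mat complex_of_real (B ^\<^sub>m k)"
      using of_real_hom.mat_hom_pow[OF B] by metis
    then show ?thesis using b[of k] that B unfolding norm_bound_def by (auto split: if_splits)
  qed
  have Bx: "t * x $ i \<le> (B *\<^sub>v x) $ i" if i: "i < n" for i
  proof -
    have "(B *\<^sub>v x) $ i = (1 / s) * (A *\<^sub>v x) $ i"
      using i x A unfolding B_def by (simp add: row_def scalar_prod_def sum_divide_distrib)
    then show ?thesis using sub[OF i] s0 by (simp add: t_def divide_right_mono)
  qed
  have B_nonneg: "B $$ (i, j) \<ge> 0" if "i < n" "j < n" for i j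
    using nonneg[OF that] that A s0 by (simp add: B_def)
  have bounded: "t ^ k \<le> (\<Sum>j<n. b * x $ j) / x $ 0" for k
  proof -
    have "1 * t ^ k * x $ 0 \<le> (B ^\<^sub>m k *\<^sub>v x) $ 0"
      using pow_mat_vec_lower_bound[OF B x B_nonneg Bx _ x, of 1 0] t n by simp
    also have "\<dots> = (\<Sum>j<n. (B ^\<^sub>m k) $$ (0, j) * x $ j)"
      using mult_mat_vec_nth[OF pow_carrier_mat[OF B] x n] .
    also have "\<dots> \<le> (\<Sum>j<n. b * x $ j)"
      using pow_le[OF n] pos by (intro sum_mono mult_right_mono) (auto simp: abs_le_iff less_imp_le)
    finally show ?thesis using pos[OF n] by (simp add: pos_le_divide_eq)
  qed
  obtain k where "(\<Sum>j<n. b * x $ j) / x $ 0 < t ^ k"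
    using real_arch_pow[OF t] by blast
  with bounded[of k] show False by simp
qed

text \<open>
  As there are only finitely many rows, a strict inequality in each of them leaves room for a larger
  factor, namely the smallest quotient \<open>(A x) i / x i\<close>.
\<close>

lemma spectral_radius_gt_if_strictly_subinvariant:
  fixes A :: "real mat"
  assumes A: "A \<in> carrier_mat n n" and n: "n > 0" and x: "x \<in> carrier_vec n"
    and nonneg: "\<And>i j. i < n \<Longrightarrow> j < n \<Longrightarrow> A $$ (i, j) \<ge> 0"
    and pos: "\<And>i. i < n \<Longrightarrow> x $ i > 0"
    and sub: "\<And>i. i < n \<Longrightarrow> r * x $ i < (A *\<^sub>v x) $ i"
  shows "r < real_spectral_radius A"
proof -
  let ?q = "(\<lambda>i. (A *\<^sub>v x) $ i / x $ i) ` {..<n}"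
  have "Min ?q \<in> ?q" using n by (intro Min_in) auto
  then have "r < Min ?q" using sub pos by (auto simp: pos_less_divide_eq)
  moreover have "Min ?q \<le> real_spectral_radius A"
  proof (rule spectral_radius_ge_if_subinvariant[OF A n x nonneg pos])
    fix i assume i: "i < n"
    then have "Min ?q \<le> (A *\<^sub>v x) $ i / x $ i" by (intro Min_le) auto
    then show "Min ?q * x $ i \<le> (A *\<^sub>v x) $ i" using pos[OF i] by (simp add: pos_le_divide_eq)
  qed
  ultimately show ?thesis by simp
qed

text \<open>
  The bound is the subinvariance of the vector of ones. If row k had a sum greater than R, the vector
  with \<open>1 + e\<close> in place k and 1 elsewhere would be strictly subinvariant for R: every other row gains the
  positive amount \<open>A i k * e\<close>, and row k has enough slack when e is small.
\<close>

lemma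
  fixes A :: "real mat"
  assumes A: "A \<in> carrier_mat n n" and n: "n > 0"
    and nonneg: "\<And>i j. i < n \<Longrightarrow> j < n \<Longrightarrow> A $$ (i, j) \<ge> 0"
    and rows: "\<And>i. i < n \<Longrightarrow> R \<le> (\<Sum>j<n. A $$ (i, j))"
  shows spectral_radius_ge_min_row_sum: "R \<le> real_spectral_radius A"
    and row_sums_eq_if_spectral_radius_eq_min:
      "\<lbrakk>real_spectral_radius A = R; \<And>i j. i < n \<Longrightarrow> j < n \<Longrightarrow> i \<noteq> j \<Longrightarrow> A $$ (i, j) > 0; k < n\<rbrakk>
        \<Longrightarrow> (\<Sum>j<n. A $$ (k, j)) = R"
proof -
  show "R \<le> real_spectral_radius A"
  proof (rule spectral_radius_ge_if_subinvariant[OF A n _ nonneg])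
    fix i assume i: "i < n"
    show "R * vec n (\<lambda>_. 1) $ i \<le> (A *\<^sub>v vec n (\<lambda>_. 1)) $ i"
      using rows[OF i] mult_mat_vec_nth[OF A _ i, of "vec n (\<lambda>_. 1)"] i by simp
  qed auto
  assume eq: "real_spectral_radius A = R" and pos: "\<And>i j. i < n \<Longrightarrow> j < n \<Longrightarrow> i \<noteq> j \<Longrightarrow> A $$ (i, j) > 0"
    and k: "k < n"
  have R: "R \<ge> 0" using spectral_radius_nonneg[OF A n] eq by simp
  show "(\<Sum>j<n. A $$ (k, j)) = R"
  proof (rule ccontr)
    assume "(\<Sum>j<n. A $$ (k, j)) \<noteq> R"
    with rows[OF k] have gt: "R < (\<Sum>j<n. A $$ (k, j))" by simp
    \<comment> \<open>The denominator ensures \<open>R * e\<close> is less than the slack of row k,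
      also when R is 0.\<close>
    define e where "e = ((\<Sum>j<n. A $$ (k, j)) - R) / (R + 1)"
    have e: "e > 0" using gt R by (simp add: e_def)
    have eR: "R * e < (\<Sum>j<n. A $$ (k, j)) - R"
    proof -
      have "(R + 1) * e = (\<Sum>j<n. A $$ (k, j)) - R" using R by (simp add: e_def)
      then show ?thesis using e by (simp add: algebra_simps)
    qed
    define x where "x = vec n (\<lambda>j. 1 + (if j = k then e else 0))"
    have x: "x \<in> carrier_vec n" by (simp add: x_def)
    have Ax: "(A *\<^sub>v x) $ i = (\<Sum>j<n. A $$ (i, j)) + A $$ (i, k) * e" if "i < n" for i
    proof -
      have "(A *\<^sub>v x) $ i = (\<Sum>j<n. A $$ (i, j) + (if j = k then A $$ (i, j) * e else 0))"
        unfolding mult_mat_vec_nth[OF A x that] by (intro sum.cong) (auto simp: x_def algebra_simps)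
      then show ?thesis using k by (simp add: sum.distrib)
    qed
    have "R < real_spectral_radius A"
    proof (rule spectral_radius_gt_if_strictly_subinvariant[OF A n x nonneg])
      fix i assume i: "i < n"
      show "x $ i > 0" using e i by (simp add: x_def)
      show "R * x $ i < (A *\<^sub>v x) $ i"
      proof (cases "i = k")
        case True
        have "A $$ (k, k) * e \<ge> 0" using nonneg[OF k k] e by simp
        then show ?thesis using True eR Ax[OF k] k by (simp add: x_def algebra_simps)
      next
        case False
        have "A $$ (i, k) * e > 0" using pos[OF i k False] e by simp
        then show ?thesis using False rows[OF i] Ax[OF i] i by (simp add: x_def)
      qed
    qed auto
    with eq show False by simp
  qed
qed


section \<open>Sums of functions whose values have no gaps\<close>

text \<open>
  By iteration, \<open>gap_free\<close> makes f take every value below each of its values. The distances from a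
  vertex have this property, as the last but one vertex of a shortest walk is one step closer.
\<close>

lemma
  fixes f :: "'a \<Rightarrow> nat"
  assumes fin: "finite A"
    and gap_free: "\<And>a. a \<in> A \<Longrightarrow> f a \<noteq> 0 \<Longrightarrow> \<exists>b\<in>A. Suc (f b) = f a"
  shows gap_free_image: "a \<in> A \<Longrightarrow> {..f a} \<subseteq> f ` A"
    and gap_free_less_card: "a \<in> A \<Longrightarrow> f a < card A"
proof -
  have img: "{..m} \<subseteq> f ` A" if "a \<in> A" "f a = m" for m a
    using that
  proof (induction m arbitrary: a)
    case 0
    then show ?case by auto
  next
    case (Suc m)
    then obtain b where "b \<in> A" "f b = m" using gap_free[of a] by auto
    then have "{..m} \<subseteq> f ` A" by (rule Suc.IH)
    moreover have "Suc m \<in> f ` A" using Suc.prems by (metis imageI)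
    ultimately show ?case by (simp add: atMost_Suc)
  qed
  then show "a \<in> A \<Longrightarrow> {..f a} \<subseteq> f ` A" by blast
  assume "a \<in> A"
  then have "card {..f a} \<le> card (f ` A)" using fin img by (intro card_mono) auto
  also have "\<dots> \<le> card A" using fin by (rule card_image_le)
  finally show "f a < card A" by simp
qed

lemma gap_free_inj_image:
  fixes f :: "'a \<Rightarrow> nat"
  assumes fin: "finite A"
    and gap_free: "\<And>a. a \<in> A \<Longrightarrow> f a \<noteq> 0 \<Longrightarrow> \<exists>b\<in>A. Suc (f b) = f a"
    and inj: "inj_on f A"
  shows "f ` A = {..<card A}"
proof (rule card_subset_eq)
  show "f ` A \<subseteq> {..<card A}" using gap_free_less_card[of A f, OF fin gap_free] by auto
  show "card (f ` A) = card {..<card A}" using inj by (simp add: card_image)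
qed simp

text \<open>
  Induction on the size of A, removing an element a at which f is maximal: this creates no gap, and
  \<open>f a \<le> card A - 1\<close>. Equality of the sums forces \<open>f a = card A - 1\<close>, and then f attains \<open>card A\<close> many
  values, so it is injective.
\<close>

lemma sum_gap_free_le_and_eq:
  fixes f :: "'a \<Rightarrow> nat"
  assumes "finite A"
    and "\<And>a. a \<in> A \<Longrightarrow> f a \<noteq> 0 \<Longrightarrow> \<exists>b\<in>A. Suc (f b) = f a"
  shows "sum f A \<le> \<Sum>{..<card A} \<and> (sum f A = \<Sum>{..<card A} \<longrightarrow> inj_on f A)"
  using assms
proof (induction "card A" arbitrary: A)
  case 0
  then show ?case by simp
next
  case (Suc m)
  from Suc.hyps(2) have ne: "A \<noteq> {}" by auto
  have "Max (f ` A) \<in> f ` A" using ne Suc.prems(1) by (intro Max_in) auto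
  then obtain a where a: "a \<in> A" "f a = Max (f ` A)" by auto
  have max: "f b \<le> f a" if "b \<in> A" for b
    unfolding a(2) using that Suc.prems(1) by (intro Max_ge) auto
  let ?B = "A - {a}"
  have card_B: "card ?B = m" using Suc.hyps(2) a(1) Suc.prems(1) by simp
  have "\<exists>c\<in>?B. Suc (f c) = f b" if "b \<in> ?B" "f b \<noteq> 0" for b
  proof -
    obtain c where c: "c \<in> A" "Suc (f c) = f b" using Suc.prems(2)[of b] \<open>b \<in> ?B\<close> \<open>f b \<noteq> 0\<close> by auto
    then have "c \<noteq> a" using max[of b] that by auto
    with c show ?thesis by auto
  qed
  then have IH: "sum f ?B \<le> \<Sum>{..<m}" using Suc.hyps(1)[of ?B] card_B Suc.prems(1) by auto
  have fa: "f a \<le> m" using gap_free_less_card[of A f a] Suc.prems a(1) Suc.hyps(2) by auto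
  have sum_A: "sum f A = f a + sum f ?B" using Suc.prems(1) a(1) by (simp add: sum.remove)
  have card_A: "\<Sum>{..<card A} = m + \<Sum>{..<m}" by (simp flip: Suc.hyps(2))
  have "inj_on f A" if "sum f A = \<Sum>{..<card A}"
  proof -
    have "f a = m" using that sum_A card_A IH fa by linarith
    then have "{..m} \<subseteq> f ` A" using gap_free_image[of A f a] Suc.prems a(1) by auto
    then have "card {..m} \<le> card (f ` A)" using Suc.prems(1) by (intro card_mono) auto
    then have "card (f ` A) = card A"
      using card_image_le[OF Suc.prems(1), of f] Suc.hyps(2) by simp
    then show ?thesis using Suc.prems(1) by (simp add: eq_card_imp_inj_on)
  qed
  then show ?case using sum_A card_A IH fa by auto
qed

lemma
  fixes f :: "'a \<Rightarrow> nat"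
  assumes fin: "finite A"
    and gap_free: "\<And>a. a \<in> A \<Longrightarrow> f a \<noteq> 0 \<Longrightarrow> \<exists>b\<in>A. Suc (f b) = f a"
  shows sum_gap_free_le: "sum f A \<le> \<Sum>{..<card A}"
    and sum_gap_free_eq_iff: "sum f A = \<Sum>{..<card A} \<longleftrightarrow> inj_on f A"
proof -
  have "sum f A = \<Sum>{..<card A}" if inj: "inj_on f A"
  proof -
    have "\<Sum>(f ` A) = sum f A" using inj by (simp add: sum.reindex)
    then show ?thesis using gap_free_inj_image[of A f, OF fin gap_free inj] by simp
  qed
  then show "sum f A \<le> \<Sum>{..<card A}" "sum f A = \<Sum>{..<card A} \<longleftrightarrow> inj_on f A"
    using sum_gap_free_le_and_eq[of A f, OF fin gap_free] by blast+
qed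

section \<open>Distances in strongly connected digraphs\<close>

context wf_digraph
begin

lemma shortest_awalkE:
  assumes "strongly_connected G" "u \<in> verts G" "w \<in> verts G"
  obtains p where "awalk u p w" "length p = digraph_dist G u w"
proof -
  let ?P = "\<lambda>k. \<exists>p. apath u p w \<and> length p = k"
  have "u \<rightarrow>\<^sup>* w" using assms by (auto simp: strongly_connected_def)
  then obtain p where "apath u p w" using reachable_apath by blast
  then have "?P (digraph_dist G u w)" unfolding digraph_dist_def by (intro LeastI[of ?P]) blast
  then show ?thesis using that by (auto simp: apath_def)
qed

lemma dist_le_awalk_length:
  assumes "awalk u p w"
  shows "digraph_dist G u w \<le> length p"
proof -
  have cost: "awalk_cost (\<lambda>_. 1) q = real (length q)" for q :: "'b list"
    by (induction q) simp_all
  have "u \<rightarrow>\<^sup>* w" using assms by (rule reachable_awalkI)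
  then have "ereal (real (digraph_dist G u w)) \<le> ereal (real (length p))"
    using digraph_dist_eq_mu[of u w] min_cost_le_walk_cost[OF assms, of "\<lambda>_. 1"] by (simp add: cost)
  then show ?thesis by simp
qed

lemma dist_self: "u \<in> verts G \<Longrightarrow> digraph_dist G u u = 0"
  using dist_le_awalk_length[of u "[]" u] by (simp add: awalk_Nil_iff)

lemma dist_eq_0_iff:
  assumes "strongly_connected G" "u \<in> verts G" "w \<in> verts G"
  shows "digraph_dist G u w = 0 \<longleftrightarrow> u = w"
proof
  assume 0: "digraph_dist G u w = 0"
  obtain p where "awalk u p w" "length p = digraph_dist G u w" by (rule shortest_awalkE[OF assms])
  with 0 show "u = w" by (simp add: awalk_Nil_iff)
qed (use dist_self assms in simp)

lemma dist_le_Suc: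
  assumes "strongly_connected G" "u \<in> verts G" "x \<rightarrow> w"
  shows "digraph_dist G u w \<le> Suc (digraph_dist G u x)"
proof -
  obtain e where e: "e \<in> arcs G" "tail G e = x" "head G e = w" using assms(3) by (auto simp: arcs_ends_def arc_to_ends_def)
  then have "x \<in> verts G" by auto
  then obtain p where p: "awalk u p x" "length p = digraph_dist G u x"
    using shortest_awalkE assms by blast
  then have "awalk u (p @ [e]) w" using e by (auto simp: awalk_simps)
  from dist_le_awalk_length[OF this] show ?thesis using p(2) by simp
qed

text \<open>
  The last arc of a shortest walk: its tail is exactly one step closer.
\<close>

lemma dist_SucE:
  assumes sc: "strongly_connected G" and u: "u \<in> verts G" and w: "w \<in> verts G"
    and d: "digraph_dist G u w = Suc k"
  obtains x where "x \<rightarrow> w" "digraph_dist G u x = k"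
proof -
  obtain p where p: "awalk u p w" "length p = Suc k" using shortest_awalkE[OF sc u w] d by metis
  then obtain q e where q: "p = q @ [e]" by (cases p rule: rev_cases) auto
  then have a: "awalk u q (tail G e)" "e \<in> arcs G" "head G e = w"
    using p by (auto simp: awalk_simps)
  then have arc: "(tail G e, w) \<in> arcs_ends G" by (auto simp: arcs_ends_def arc_to_ends_def)
  have "digraph_dist G u (tail G e) \<le> k" using dist_le_awalk_length[OF a(1)] p q by simp
  moreover have "k \<le> digraph_dist G u (tail G e)" using dist_le_Suc[OF sc u arc] d by simp
  ultimately show ?thesis using that arc by simp
qed

end

context digraph
begin

lemma dist_gap_free:
  assumes "strongly_connected G" "u \<in> verts G" "w \<in> verts G" "digraph_dist G u w \<noteq> 0"
  shows "\<exists>x\<in>verts G. Suc (digraph_dist G u x) = digraph_dist G u w"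
proof -
  obtain k where k: "digraph_dist G u w = Suc k" using assms(4) by (cases "digraph_dist G u w") auto
  then obtain x where "x \<rightarrow> w" "digraph_dist G u x = k" using dist_SucE[OF assms(1-3)] by blast
  with k show ?thesis by (auto intro: adj_in_verts(1))
qed

lemma dist_eq_1_iff:
  assumes sc: "strongly_connected G" and u: "u \<in> verts G" and w: "w \<in> verts G"
  shows "digraph_dist G u w = 1 \<longleftrightarrow> u \<rightarrow> w"
proof
  assume "digraph_dist G u w = 1"
  then obtain x where x: "x \<rightarrow> w" "digraph_dist G u x = 0"
    using dist_SucE[OF sc u w, of 0] by auto
  then show "u \<rightarrow> w" using dist_eq_0_iff[OF sc u] by (auto simp: adj_in_verts(1))
next
  assume uw: "u \<rightarrow> w"
  then have "u \<noteq> w" using adj_not_same by blast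
  then show "digraph_dist G u w = 1"
    using dist_le_Suc[OF sc u uw] dist_eq_0_iff[OF sc u w] dist_self[OF u] by simp
qed

lemma
  assumes sc: "strongly_connected G" and u: "u \<in> verts G"
  shows sum_dist_ge_card: "card (verts G) - 1 \<le> (\<Sum>w\<in>verts G. digraph_dist G u w)"
    and sum_dist_eq_card_iff: "(\<Sum>w\<in>verts G. digraph_dist G u w) = card (verts G) - 1
      \<longleftrightarrow> (\<forall>w\<in>verts G. u \<noteq> w \<longrightarrow> u \<rightarrow> w)"
proof -
  let ?W = "verts G - {u}"
  have sum: "(\<Sum>w\<in>verts G. digraph_dist G u w) = (\<Sum>w\<in>?W. digraph_dist G u w)"
    using u dist_self[OF u] by (simp add: sum.remove[of _ u])
  have ones: "(\<Sum>w\<in>?W. 1) = card (verts G) - 1" using u by simp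
  have ge: "1 \<le> digraph_dist G u w" if "w \<in> ?W" for w
    using that dist_eq_0_iff[OF sc u, of w] by (cases "digraph_dist G u w") auto
  show "card (verts G) - 1 \<le> (\<Sum>w\<in>verts G. digraph_dist G u w)"
    unfolding sum ones[symmetric] using ge by (rule sum_mono)
  have "(\<Sum>w\<in>?W. digraph_dist G u w) = (\<Sum>w\<in>?W. 1) \<longleftrightarrow> (\<forall>w\<in>?W. digraph_dist G u w = 1)"
  proof
    assume eq: "(\<Sum>w\<in>?W. digraph_dist G u w) = (\<Sum>w\<in>?W. 1)"
    show "\<forall>w\<in>?W. digraph_dist G u w = 1"
    proof
      fix w assume "w \<in> ?W"
      have "1 = digraph_dist G u w"
        by (rule sum_mono_inv[OF eq[symmetric] ge \<open>w \<in> ?W\<close>]) auto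
      then show "digraph_dist G u w = 1" by simp
    qed
  qed simp
  also have "\<dots> \<longleftrightarrow> (\<forall>w\<in>verts G. u \<noteq> w \<longrightarrow> u \<rightarrow> w)"
    using dist_eq_1_iff[OF sc u] by auto
  finally show "(\<Sum>w\<in>verts G. digraph_dist G u w) = card (verts G) - 1
      \<longleftrightarrow> (\<forall>w\<in>verts G. u \<noteq> w \<longrightarrow> u \<rightarrow> w)" unfolding sum ones .
qed

lemma sum_dist_le:
  assumes "strongly_connected G" "u \<in> verts G"
  shows "(\<Sum>w\<in>verts G. digraph_dist G u w) \<le> \<Sum>{..<card (verts G)}"
  using finite_verts dist_gap_free[OF assms] by (rule sum_gap_free_le)

lemma sum_dist_eq_iff:
  assumes "strongly_connected G" "u \<in> verts G"
  shows "(\<Sum>w\<in>verts G. digraph_dist G u w) = \<Sum>{..<card (verts G)}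
    \<longleftrightarrow> inj_on (digraph_dist G u) (verts G)"
  using finite_verts dist_gap_free[OF assms] by (rule sum_gap_free_eq_iff)

text \<open>
  If the distances from u are injective, they are \<open>0, \<dots>, n - 1\<close>, and the out-neighbours of u are the
  vertices at distance 1, of which there is exactly one. Conversely, with out-degrees equal to 1, the
  vertex at distance \<open>k + 1\<close> is the only out-neighbour of the vertex at distance k.
\<close>

lemma inj_on_dist_iff_unique_out_neighbour:
  assumes sc: "strongly_connected G" and card: "card (verts G) \<ge> 2"
  shows "(\<forall>u\<in>verts G. inj_on (digraph_dist G u) (verts G)) \<longleftrightarrow> (\<forall>u\<in>verts G. \<exists>!w. u \<rightarrow> w)"
proof (intro iffI ballI)
  fix u assume inj: "\<forall>u\<in>verts G. inj_on (digraph_dist G u) (verts G)" and u: "u \<in> verts G"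
  have "digraph_dist G u ` verts G = {..<card (verts G)}"
    using inj u dist_gap_free[OF sc u] by (intro gap_free_inj_image) auto
  moreover have "1 \<in> {..<card (verts G)}" using card by simp
  ultimately obtain w where w: "w \<in> verts G" "digraph_dist G u w = 1" by (metis imageE)
  show "\<exists>!w. u \<rightarrow> w"
  proof (rule ex1I)
    show "u \<rightarrow> w" using w dist_eq_1_iff[OF sc u] by simp
    fix w' assume "u \<rightarrow> w'"
    then have "w' \<in> verts G" "digraph_dist G u w' = 1"
      using dist_eq_1_iff[OF sc u] by (auto simp: adj_in_verts(2))
    then show "w' = w" using inj u w by (metis inj_onD)
  qed
next
  fix u assume out: "\<forall>u\<in>verts G. \<exists>!w. u \<rightarrow> w" and u: "u \<in> verts G"
  have "w = w'" if "w \<in> verts G" "w' \<in> verts G" "digraph_dist G u w = k" "digraph_dist G u w' = k"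
    for k w w'
    using that
  proof (induction k arbitrary: w w')
    case 0
    then show ?case using dist_eq_0_iff[OF sc u] by simp
  next
    case (Suc k)
    obtain x where x: "x \<rightarrow> w" "digraph_dist G u x = k"
      using dist_SucE[OF sc u Suc.prems(1,3)] by blast
    obtain x' where x': "x' \<rightarrow> w'" "digraph_dist G u x' = k"
      using dist_SucE[OF sc u Suc.prems(2,4)] by blast
    have v: "x \<in> verts G" "x' \<in> verts G" using x x' by (auto simp: adj_in_verts(1))
    then have "x = x'" using Suc.IH x x' by blast
    then show ?case using out v x(1) x'(1) by blast
  qed
  then show "inj_on (digraph_dist G u) (verts G)" by (auto intro!: inj_onI)
qed

section \<open>Isomorphisms to the complete digraph and to the directed cycle\<close>

text \<open>
  An isomorphism carries its own tail and head functions on the target arcs. When the target arcs are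
  pairs of vertices and there are no multiple arcs, it is determined by its action on the vertices.
\<close>

lemma digraph_iso_pair_digraph_iff:
  assumes E: "E \<subseteq> V \<times> V"
  shows "digraph_iso G \<lparr>verts = V, arcs = E, tail = fst, head = snd\<rparr> \<longleftrightarrow>
    (\<exists>h. bij_betw h (verts G) V \<and>
      (\<forall>u\<in>verts G. \<forall>w\<in>verts G. u \<rightarrow> w \<longleftrightarrow> (h u, h w) \<in> E))"
    (is "digraph_iso G ?H \<longleftrightarrow> _")
proof
  assume "digraph_iso G ?H"
  then obtain f where f: "digraph_isomorphism f" and H: "?H = app_iso f G"
    by (auto simp: digraph_iso_def)
  have V: "V = iso_verts f ` verts G" and E_img: "E = iso_arcs f ` arcs G"
    and ends: "iso_tail f = fst" "iso_head f = snd"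
    using H by (simp_all add: app_iso_def)
  let ?h = "iso_verts f"
  have inj: "inj_on ?h (verts G)" using f by (simp add: digraph_isomorphism_def)
  have arc: "iso_arcs f e = (?h (tail G e), ?h (head G e))" if "e \<in> arcs G" for e
    using f that ends by (auto simp: digraph_isomorphism_def prod_eq_iff)
  have "u \<rightarrow> w \<longleftrightarrow> (?h u, ?h w) \<in> E" if uw: "u \<in> verts G" "w \<in> verts G" for u w
  proof
    assume "u \<rightarrow> w"
    then obtain e where "e \<in> arcs G" "tail G e = u" "head G e = w"
      by (auto simp: arcs_ends_def arc_to_ends_def)
    with arc[of e] show "(?h u, ?h w) \<in> E" unfolding E_img by (metis imageI)
  next
    assume "(?h u, ?h w) \<in> E"
    then obtain e where e: "e \<in> arcs G" "iso_arcs f e = (?h u, ?h w)" unfolding E_img by auto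
    with arc have "?h (tail G e) = ?h u" "?h (head G e) = ?h w" by auto
    then have "tail G e = u" "head G e = w" using inj uw e(1) by (auto dest: inj_onD)
    with e(1) show "u \<rightarrow> w" by (auto simp: arcs_ends_def arc_to_ends_def)
  qed
  moreover have "bij_betw ?h (verts G) V" using inj V by (simp add: bij_betw_def)
  ultimately show "\<exists>h. bij_betw h (verts G) V \<and>
      (\<forall>u\<in>verts G. \<forall>w\<in>verts G. u \<rightarrow> w \<longleftrightarrow> (h u, h w) \<in> E)" by blast
next
  assume "\<exists>h. bij_betw h (verts G) V \<and>
      (\<forall>u\<in>verts G. \<forall>w\<in>verts G. u \<rightarrow> w \<longleftrightarrow> (h u, h w) \<in> E)"
  then obtain h where h: "bij_betw h (verts G) V"
    and hE: "\<And>u w. u \<in> verts G \<Longrightarrow> w \<in> verts G \<Longrightarrow> u \<rightarrow> w \<longleftrightarrow> (h u, h w) \<in> E" by blast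
  define f where "f = \<lparr>iso_verts = h, iso_arcs = (\<lambda>e. (h (tail G e), h (head G e))),
    iso_head = snd, iso_tail = fst\<rparr>"
  have inj: "inj_on h (verts G)" using h by (simp add: bij_betw_def)
  have "inj_on (iso_arcs f) (arcs G)"
  proof (rule inj_onI)
    fix e e' assume e: "e \<in> arcs G" "e' \<in> arcs G" "iso_arcs f e = iso_arcs f e'"
    then have "tail G e = tail G e'" "head G e = head G e'"
      using inj by (auto simp: f_def dest: inj_onD)
    then show "e = e'" using no_multi_arcs e by (auto simp: arc_to_ends_def)
  qed
  then have "digraph_isomorphism f"
    using inj by (simp add: digraph_isomorphism_def wf_digraph_axioms) (simp add: f_def)
  moreover have "?H = app_iso f G"
  proof -
    have "E = iso_arcs f ` arcs G"
    proof (intro equalityI subsetI)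
      fix p assume p: "p \<in> E"
      then have "fst p \<in> h ` verts G" "snd p \<in> h ` verts G"
        using E h by (auto simp: bij_betw_def)
      then obtain u w where uw: "u \<in> verts G" "w \<in> verts G" "p = (h u, h w)"
        by (metis imageE prod.collapse)
      then have "u \<rightarrow> w" using p hE by simp
      then obtain e where "e \<in> arcs G" "tail G e = u" "head G e = w"
        by (auto simp: arcs_ends_def arc_to_ends_def)
      then show "p \<in> iso_arcs f ` arcs G" using uw(3) by (auto simp: f_def)
    next
      fix p assume "p \<in> iso_arcs f ` arcs G"
      then obtain e where e: "e \<in> arcs G" "p = (h (tail G e), h (head G e))" by (auto simp: f_def)
      moreover have "tail G e \<rightarrow>\<^bsub>G\<^esub> head G e" using e(1) by (auto simp: arcs_ends_def arc_to_ends_def)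
      ultimately show "p \<in> E" using hE by auto
    qed
    then show ?thesis using h by (simp add: app_iso_def f_def bij_betw_def)
  qed
  ultimately show "digraph_iso G ?H" by (auto simp: digraph_iso_def)
qed

lemma digraph_iso_complete_iff:
  assumes "card (verts G) = n"
  shows "digraph_iso G (complete_digraph_on n) \<longleftrightarrow>
    (\<forall>u\<in>verts G. \<forall>w\<in>verts G. u \<noteq> w \<longrightarrow> u \<rightarrow> w)"
proof -
  let ?E = "{(i, j). i < n \<and> j < n \<and> i \<noteq> j}"
  have iff: "digraph_iso G (complete_digraph_on n) \<longleftrightarrow> (\<exists>h. bij_betw h (verts G) {..<n} \<and>
      (\<forall>u\<in>verts G. \<forall>w\<in>verts G. u \<rightarrow> w \<longleftrightarrow> (h u, h w) \<in> ?E))"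
    unfolding complete_digraph_on_def by (rule digraph_iso_pair_digraph_iff) auto
  have "(h u, h w) \<in> ?E \<longleftrightarrow> u \<noteq> w"
    if "bij_betw h (verts G) {..<n}" "u \<in> verts G" "w \<in> verts G" for h u w
    using that by (auto simp: bij_betw_def inj_on_eq_iff)
  then have "digraph_iso G (complete_digraph_on n) \<longleftrightarrow> (\<exists>h. bij_betw h (verts G) {..<n} \<and>
      (\<forall>u\<in>verts G. \<forall>w\<in>verts G. u \<rightarrow> w \<longleftrightarrow> u \<noteq> w))"
    unfolding iff by meson
  moreover have "\<exists>h. bij_betw h (verts G) {..<n}"
    using ex_bij_betw_finite_nat[OF finite_verts] assms by (auto simp: lessThan_atLeast0)
  ultimately show ?thesis using adj_not_same by blast
qed

text \<open>
  Number the vertices by their distance from a fixed vertex r. The out-neighbour of the vertex k is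
  \<open>k + 1\<close>, as the latter has an in-neighbour at distance k. By strong connectivity r has an in-neighbour
  too, and only the vertex \<open>n - 1\<close>, whose out-neighbour is not yet accounted for, can be it.
\<close>

lemma cycle_numbering_if_unique_out_neighbour:
  assumes sc: "strongly_connected G" and n: "card (verts G) = n" "n \<ge> 2"
    and out: "\<forall>u\<in>verts G. \<exists>!w. u \<rightarrow> w"
  shows "\<exists>h. bij_betw h (verts G) {..<n} \<and>
    (\<forall>u\<in>verts G. \<forall>w\<in>verts G. u \<rightarrow> w \<longleftrightarrow> h w = Suc (h u) mod n)"
proof -
  obtain r where r: "r \<in> verts G" using n by (metis all_not_in_conv card.empty not_numeral_le_zero)
  let ?h = "digraph_dist G r"
  have inj: "inj_on ?h (verts G)"
    using inj_on_dist_iff_unique_out_neighbour[OF sc] n out r by blast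
  have img: "?h ` verts G = {..<n}"
    using gap_free_inj_image[OF finite_verts dist_gap_free[OF sc r] inj] n by blast
  have step: "u \<rightarrow> w" if u: "u \<in> verts G" and w: "w \<in> verts G" "?h w = Suc (?h u)" for u w
  proof -
    obtain x where x: "x \<rightarrow> w" "?h x = ?h u" using dist_SucE[OF sc r w] by blast
    then have "x = u" using inj u by (auto simp: adj_in_verts(1) dest: inj_onD)
    with x show ?thesis by simp
  qed
  have last: "u \<rightarrow> r" if u: "u \<in> verts G" "?h u = n - 1" for u
  proof -
    have "n - 1 \<noteq> 0" using n by simp
    then have "u \<noteq> r" using u(2) dist_self[OF r] by auto
    then have "u \<rightarrow>\<^sup>+ r"
      using sc u(1) r
      by (auto simp: strongly_connected_def reachable_conv' dest: reachable_neq_reachable1)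
    then obtain x where x: "x \<rightarrow> r"
      by (meson tranclE)
    then have xv: "x \<in> verts G" by (auto simp: adj_in_verts(1))
    have "?h x = n - 1"
    proof (rule ccontr)
      assume "?h x \<noteq> n - 1"
      moreover have "?h x < n" using img xv by auto
      ultimately have "Suc (?h x) \<in> ?h ` verts G" unfolding img by auto
      then obtain w where w: "w \<in> verts G" "?h w = Suc (?h x)" by (metis imageE)
      then have "w = r" using step[OF xv] x out xv by blast
      then show False using w(2) dist_self[OF r] by simp
    qed
    then have "x = u" using inj xv u by (metis inj_onD)
    with x show ?thesis by simp
  qed
  have "u \<rightarrow> w \<longleftrightarrow> ?h w = Suc (?h u) mod n" if uw: "u \<in> verts G" "w \<in> verts G" for u w
  proof -
    have "\<exists>x\<in>verts G. u \<rightarrow> x \<and> ?h x = Suc (?h u) mod n"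
    proof (cases "?h u = n - 1")
      case True
      then show ?thesis using last[OF uw(1)] r dist_self[OF r] n by (intro bexI[of _ r]) auto
    next
      case False
      moreover have "?h u < n" using img uw(1) by auto
      ultimately have lt: "Suc (?h u) < n" by simp
      then have "Suc (?h u) \<in> ?h ` verts G" unfolding img by simp
      then obtain x where "x \<in> verts G" "?h x = Suc (?h u)" by (metis imageE)
      then show ?thesis using step[OF uw(1)] lt by (intro bexI[of _ x]) auto
    qed
    then obtain x where x: "x \<in> verts G" "u \<rightarrow> x" "?h x = Suc (?h u) mod n" by blast
    show ?thesis
    proof
      assume "u \<rightarrow> w"
      then have "w = x" using x(2) out uw(1) by blast
      then show "?h w = Suc (?h u) mod n" using x(3) by simp
    next
      assume "?h w = Suc (?h u) mod n"
      then have "w = x" using inj uw(2) x(1,3) by (metis inj_onD)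
      then show "u \<rightarrow> w" using x(2) by simp
    qed
  qed
  then show ?thesis using inj img by (auto simp: bij_betw_def)
qed

lemma digraph_iso_cycle_iff:
  assumes sc: "strongly_connected G" and n: "card (verts G) = n" "n \<ge> 2"
  shows "digraph_iso G (directed_cycle n) \<longleftrightarrow> (\<forall>u\<in>verts G. \<exists>!w. u \<rightarrow> w)"
proof -
  let ?E = "{(i, Suc i mod n) | i. i < n}"
  have "digraph_iso G (directed_cycle n) \<longleftrightarrow> (\<exists>h. bij_betw h (verts G) {..<n} \<and>
      (\<forall>u\<in>verts G. \<forall>w\<in>verts G. u \<rightarrow> w \<longleftrightarrow> (h u, h w) \<in> ?E))"
    unfolding directed_cycle_def using n by (intro digraph_iso_pair_digraph_iff) auto
  also have "\<dots> \<longleftrightarrow> (\<exists>h. bij_betw h (verts G) {..<n} \<and>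
      (\<forall>u\<in>verts G. \<forall>w\<in>verts G. u \<rightarrow> w \<longleftrightarrow> h w = Suc (h u) mod n))" (is "_ \<longleftrightarrow> ?iso")
    by (intro ex_cong1 conj_cong refl ball_cong) (auto simp: bij_betw_def)
  also have "\<dots> \<longleftrightarrow> (\<forall>u\<in>verts G. \<exists>!w. u \<rightarrow> w)"
  proof (intro iffI ballI)
    fix u assume ?iso and u: "u \<in> verts G"
    then obtain h where h: "bij_betw h (verts G) {..<n}"
      "\<And>w. w \<in> verts G \<Longrightarrow> u \<rightarrow> w \<longleftrightarrow> h w = Suc (h u) mod n" by blast
    have "Suc (h u) mod n \<in> h ` verts G" using h(1) n by (simp add: bij_betw_def)
    then obtain w where w: "w \<in> verts G" "h w = Suc (h u) mod n" by (metis imageE)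
    show "\<exists>!w. u \<rightarrow> w"
    proof (rule ex1I)
      show "u \<rightarrow> w" using w h(2) by simp
      fix w' assume "u \<rightarrow> w'"
      then have "w' \<in> verts G" by (rule adj_in_verts(2))
      moreover from this have "h w' = h w" using \<open>u \<rightarrow> w'\<close> w h(2) by simp
      ultimately show "w' = w" using w(1) bij_betw_imp_inj_on[OF h(1)] by (metis inj_onD)
    qed
  next
    assume out: "\<forall>u\<in>verts G. \<exists>!w. u \<rightarrow> w"
    then show ?iso using cycle_numbering_if_unique_out_neighbour[OF sc n] by blast
  qed
  finally show ?thesis .
qed

end

section \<open>The bounds on the spectral radius\<close>

lemma
  assumes v: "bij_betw v {..<n} (verts G)" and i: "i < n"
  shows transmission_eq_sum_dist: "transmission G n v i = real (\<Sum>w\<in>verts G. digraph_dist G (v i) w)"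
    and D_alpha_row_sum: "(\<Sum>j<n. D_alpha_matrix \<alpha> G n v $$ (i, j)) = transmission G n v i"
proof -
  have "transmission G n v i = (\<Sum>j<n. real (digraph_dist G (v i) (v j)))"
    using i by (simp add: transmission_def distance_matrix_def)
  also have "\<dots> = (\<Sum>w\<in>verts G. real (digraph_dist G (v i) w))"
    by (rule sum.reindex_bij_betw[OF v])
  finally show "transmission G n v i = real (\<Sum>w\<in>verts G. digraph_dist G (v i) w)" by simp
  have "(\<Sum>j<n. D_alpha_matrix \<alpha> G n v $$ (i, j))
      = (\<Sum>j<n. (if i = j then \<alpha> * transmission G n v i else 0)
          + (1 - \<alpha>) * distance_matrix G n v $$ (i, j))"
    using i by (intro sum.cong) (auto simp: D_alpha_matrix_def mat_diag_def distance_matrix_def)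
  also have "\<dots> = \<alpha> * transmission G n v i + (1 - \<alpha>) * transmission G n v i"
    using i by (simp add: sum.distrib transmission_def sum_distrib_left)
  finally show "(\<Sum>j<n. D_alpha_matrix \<alpha> G n v $$ (i, j)) = transmission G n v i"
    by (simp add: algebra_simps)
qed

theorem theorem2p6:
  fixes G :: "('a, 'b) pre_digraph" and \<alpha> :: real and n :: nat and v :: "nat \<Rightarrow> 'a"
  assumes "0 \<le> \<alpha>" and "\<alpha> < 1"
    and "n \<ge> 2"
    and "digraph G" and "strongly_connected G"
    and "card (verts G) = n"
    and "bij_betw v {..<n} (verts G)"
  shows "real n - 1 \<le> D_alpha_spectral_radius \<alpha> G n v
    \<and> D_alpha_spectral_radius \<alpha> G n v \<le> real n * (real n - 1) / 2
    \<and> (D_alpha_spectral_radius \<alpha> G n v = real n - 1 \<longleftrightarrow> digraph_iso G (complete_digraph_on n))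
    \<and> (D_alpha_spectral_radius \<alpha> G n v = real n * (real n - 1) / 2 \<longleftrightarrow> digraph_iso G (directed_cycle n))"
proof -
  interpret digraph G by fact
  note sc = \<open>strongly_connected G\<close> and card = \<open>card (verts G) = n\<close>
    and v = \<open>bij_betw v {..<n} (verts G)\<close>
  let ?M = "D_alpha_matrix \<alpha> G n v"
  let ?row = "\<lambda>i. \<Sum>j<n. ?M $$ (i, j)"
  let ?tr = "\<lambda>u. \<Sum>w\<in>verts G. digraph_dist G u w"
  have n: "n > 0" using \<open>n \<ge> 2\<close> by simp
  have vi: "v i \<in> verts G" if "i < n" for i using v that by (auto simp: bij_betw_def)
  have M: "?M \<in> carrier_mat n n"
    by (simp add: D_alpha_matrix_def mat_diag_def distance_matrix_def)
  have row: "?row i = real (?tr (v i))" if "i < n" for i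
    using D_alpha_row_sum[OF v that] transmission_eq_sum_dist[OF v that] by simp
  have nonneg: "?M $$ (i, j) \<ge> 0" if "i < n" "j < n" for i j
  proof -
    have "transmission G n v i \<ge> 0"
      using transmission_eq_sum_dist[OF v that(1)] by (metis of_nat_0_le_iff)
    then show ?thesis
      using that \<open>0 \<le> \<alpha>\<close> \<open>\<alpha> < 1\<close>
      by (auto simp: D_alpha_matrix_def mat_diag_def distance_matrix_def intro!: add_nonneg_nonneg)
  qed
  have pos: "?M $$ (i, j) > 0" if ij: "i < n" "j < n" "i \<noteq> j" for i j
  proof -
    have "v i \<noteq> v j" using v ij by (auto simp: bij_betw_def dest: inj_onD)
    then have "digraph_dist G (v i) (v j) \<noteq> 0" using dist_eq_0_iff[OF sc vi vi] ij by simp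
    then show ?thesis
      using ij \<open>\<alpha> < 1\<close> by (simp add: D_alpha_matrix_def mat_diag_def distance_matrix_def)
  qed
  have max_sum: "real (\<Sum>{..<n}) = real n * (real n - 1) / 2"
  proof -
    have "2 * real (\<Sum>{..<n}) = real n * (real n - 1)"
      by (induction n) (auto simp: algebra_simps)
    then show ?thesis by simp
  qed
  have ge: "real n - 1 \<le> ?row i" if "i < n" for i
    using sum_dist_ge_card[OF sc vi[OF that]] n
    by (simp add: row[OF that] card of_nat_diff del: of_nat_sum)
  have le: "?row i \<le> real n * (real n - 1) / 2" if "i < n" for i
    using sum_dist_le[OF sc vi[OF that]]
    by (simp add: row[OF that] card max_sum[symmetric] del: of_nat_sum)
  have lower: "real n - 1 \<le> real_spectral_radius ?M"
    by (rule spectral_radius_ge_min_row_sum[OF M n nonneg ge])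
  have upper: "real_spectral_radius ?M \<le> real n * (real n - 1) / 2"
    by (rule spectral_radius_le_max_row_sum[OF M n nonneg le])
  have all: "(\<forall>i<n. P (v i)) \<longleftrightarrow> (\<forall>u\<in>verts G. P u)" for P
    unfolding bij_betw_imp_surj_on[OF v, symmetric] by auto
  have "real_spectral_radius ?M = real n - 1 \<longleftrightarrow> (\<forall>i<n. ?row i = real n - 1)"
  proof
    assume "real_spectral_radius ?M = real n - 1"
    then show "\<forall>i<n. ?row i = real n - 1"
      using row_sums_eq_if_spectral_radius_eq_min[OF M n nonneg ge _ pos] by blast
  next
    assume "\<forall>i<n. ?row i = real n - 1"
    then have "real_spectral_radius ?M \<le> real n - 1"
      by (intro spectral_radius_le_max_row_sum[OF M n nonneg]) auto
    with lower show "real_spectral_radius ?M = real n - 1" by simp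
  qed
  also have "\<dots> \<longleftrightarrow> (\<forall>i<n. ?tr (v i) = n - 1)"
  proof -
    have "real (?tr (v i)) = real n - 1 \<longleftrightarrow> ?tr (v i) = n - 1" for i using n by linarith
    then show ?thesis using row by simp
  qed
  also have "\<dots> \<longleftrightarrow> digraph_iso G (complete_digraph_on n)"
    unfolding all[of "\<lambda>u. ?tr u = n - 1"] digraph_iso_complete_iff[OF card]
    using sum_dist_eq_card_iff[OF sc] card by simp
  finally have complete: "real_spectral_radius ?M = real n - 1
    \<longleftrightarrow> digraph_iso G (complete_digraph_on n)" .
  have "real_spectral_radius ?M = real n * (real n - 1) / 2
    \<longleftrightarrow> (\<forall>i<n. ?row i = real n * (real n - 1) / 2)"
  proof
    assume "real_spectral_radius ?M = real n * (real n - 1) / 2"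
    then show "\<forall>i<n. ?row i = real n * (real n - 1) / 2"
      using row_sums_eq_if_spectral_radius_eq_max[OF M n nonneg le _ pos] by blast
  next
    assume "\<forall>i<n. ?row i = real n * (real n - 1) / 2"
    then have "real n * (real n - 1) / 2 \<le> real_spectral_radius ?M"
      by (intro spectral_radius_ge_min_row_sum[OF M n nonneg]) auto
    with upper show "real_spectral_radius ?M = real n * (real n - 1) / 2" by simp
  qed
  also have "\<dots> \<longleftrightarrow> (\<forall>i<n. ?tr (v i) = \<Sum>{..<n})"
    using row by (simp add: max_sum[symmetric] del: of_nat_sum)
  also have "\<dots> \<longleftrightarrow> digraph_iso G (directed_cycle n)"
    unfolding all[of "\<lambda>u. ?tr u = \<Sum>{..<n}"] digraph_iso_cycle_iff[OF sc card \<open>n \<ge> 2\<close>]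
    using inj_on_dist_iff_unique_out_neighbour[OF sc] sum_dist_eq_iff[OF sc] card \<open>n \<ge> 2\<close> by simp
  finally have cycle: "real_spectral_radius ?M = real n * (real n - 1) / 2
    \<longleftrightarrow> digraph_iso G (directed_cycle n)" .
  show ?thesis
    unfolding D_alpha_spectral_radius_def using lower upper complete cycle by blast
qed

end
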